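(* Let $A\in\mathbb{R}^{m\times n}$ with $m\le n$, and let $p>n$. Then $A$ has the strong inner product property if and only if the $m\times p$ matrix $B=\left[\begin{array}{c|c}A & O\end{array}\right]$ (where $O$ is the $m\times(p-n)$ zero matrix) has the strong inner product property.
   Context: All matrices are real; $\circ$ denotes the Hadamard product. A matrix $M\in\mathbb{R}^{m\times n}$ with $m\le n$ has the strong inner product property (SIPP) if $M$ has rank $m$ and $X=O$ is the only symmetric $m\times m$ matrix $X$ with $(XM)\circ M=O$. *)

theory Defs
  imports "Jordan_Normal_Form.DL_Rank"
begin

(* Only used for matrices of equal dimensions. *)
definition hadamard :: "'a :: times mat \<Rightarrow> 'a mat \<Rightarrow> 'a mat" (infixl "\<circ>\<^sub>H" 70) where
  "M \<circ>\<^sub>H N = mat (dim_row M) (dim_col M) (\<lambda>(i, j). M $$ (i, j) * N $$ (i, j))"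

(* Column analogue of append_rows: the block matrix [A | B]. *)
definition append_cols :: "'a :: zero mat \<Rightarrow> 'a mat \<Rightarrow> 'a mat" (infixr "@\<^sub>c" 65) where
  "A @\<^sub>c B = four_block_mat A B (0\<^sub>m 0 (dim_col A)) (0\<^sub>m 0 (dim_col B))"

(* The first value argument of vec_space.rank is the dimension of the space containing
   the columns, i.e. the number of rows. *)
definition has_SIPP :: "real mat \<Rightarrow> bool" where
  "has_SIPP M \<longleftrightarrow>
     dim_row M \<le> dim_col M \<and>
     vec_space.rank (dim_row M) M = dim_row M \<and>
     (\<forall>X \<in> carrier_mat (dim_row M) (dim_row M).
        X\<^sup>T = X \<longrightarrow> (X * M) \<circ>\<^sub>H M = 0\<^sub>m (dim_row M) (dim_col M) \<longrightarrow>
        X = 0\<^sub>m (dim_row M) (dim_row M))"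

end

theory Submission
  imports Defs
begin

text \<open>Each clause of the property is insensitive to zero columns. The shape condition holds on
  both sides because m \<le> n < p. The rank agrees because zero columns do not enlarge the column
  space (\<open>rank_append_zero_cols\<close>). For the last clause, left multiplication and the
  Hadamard product both act block by block (\<open>mult_append_cols\<close>,
  \<open>hadamard_append_cols\<close>), so for every X the product built from B is the one built
  from A followed by a zero block. One vanishes exactly when the other does.\<close>

lemma dim_append_cols [simp]:
  "dim_row (A @\<^sub>c B) = dim_row A"
  "dim_col (A @\<^sub>c B) = dim_col A + dim_col B"
  by (simp_all add: append_cols_def)

lemma append_cols_carrier:
  assumes "A \<in> carrier_mat m n" and "B \<in> carrier_mat m k"
  shows "A @\<^sub>c B \<in> carrier_mat m (n + k)"
  using assms unfolding append_cols_def by auto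

lemma index_append_cols:
  assumes "i < dim_row A" and "j < dim_col A + dim_col B"
  shows "(A @\<^sub>c B) $$ (i, j) =
    (if j < dim_col A then A $$ (i, j) else B $$ (i, j - dim_col A))"
  using assms unfolding append_cols_def by auto

lemma col_append_cols:
  assumes "A \<in> carrier_mat m n" and "B \<in> carrier_mat m k" and "j < n + k"
  shows "col (A @\<^sub>c B) j = (if j < n then col A j else col B (j - n))"
  using assms by (intro eq_vecI) (auto simp: index_append_cols)

lemma set_cols_append_cols:
  assumes "A \<in> carrier_mat m n" and "B \<in> carrier_mat m k"
  shows "set (cols (A @\<^sub>c B)) = set (cols A) \<union> set (cols B)"
proof -
  \<comment> \<open>Column n + j of the block matrix is column j of the right block, so this
    splitting of the indices splits the set of columns.\<close>
  have "{..<n + k} = {..<n} \<union> (\<lambda>j. n + j) ` {..<k}"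
    by (simp add: lessThan_atLeast0 ivl_disj_un add.commute)
  then show ?thesis
    using assms
    by (simp add: cols_def atLeast0LessThan image_Un image_image col_append_cols[OF assms])
qed

text \<open>Rank is the dimension of the span of the columns, so it suffices that the two spans
  coincide; the only vector that can be new is zero.\<close>

lemma rank_append_zero_cols:
  fixes A :: "'a :: field mat"
  assumes A: "A \<in> carrier_mat m n"
  shows "vec_space.rank m (A @\<^sub>c 0\<^sub>m m k) = vec_space.rank m A"
proof -
  interpret vec_space "TYPE('a)" m .
  let ?B = "A @\<^sub>c 0\<^sub>m m k"
  have cols: "set (cols ?B) = set (cols A) \<union> set (cols (0\<^sub>m m k))"
    by (rule set_cols_append_cols[OF A zero_carrier_mat])
  have zero: "set (cols (0\<^sub>m m k)) \<subseteq> {0\<^sub>v m :: 'a vec}"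
    by (auto simp: cols_def)
  have A': "set (cols A) \<subseteq> carrier_vec m"
    using A cols_dim by blast
  \<comment> \<open>The zero vector lies in every span, even that of the empty set, so the case of A
    without columns is covered.\<close>
  have "set (cols ?B) \<subseteq> span (set (cols A))"
    using cols zero in_own_span[OF A'] vectorspace.span_zero[OF vectorspace_axioms] by auto
  then have "span (set (cols ?B)) \<subseteq> span (set (cols A))"
    using A' by (intro span_is_subset[OF _ span_is_submodule]) auto
  moreover have "span (set (cols A)) \<subseteq> span (set (cols ?B))"
    using cols by (intro span_is_monotone) auto
  ultimately show ?thesis
    unfolding rank_def by simp
qed

lemma mult_append_cols:
  fixes X :: "'a :: semiring_0 mat"
  assumes "X \<in> carrier_mat l m" and "A \<in> carrier_mat m n" and "B \<in> carrier_mat m k"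
  shows "X * (A @\<^sub>c B) = (X * A) @\<^sub>c (X * B)"
  using assms by (intro eq_matI) (auto simp: index_append_cols col_append_cols)

lemma hadamard_append_cols:
  assumes "A \<in> carrier_mat m n" and "B \<in> carrier_mat m k"
    and "A' \<in> carrier_mat m n" and "B' \<in> carrier_mat m k"
  shows "(A @\<^sub>c B) \<circ>\<^sub>H (A' @\<^sub>c B') = (A \<circ>\<^sub>H A') @\<^sub>c (B \<circ>\<^sub>H B')"
  using assms by (intro eq_matI) (auto simp: hadamard_def index_append_cols)

lemma append_zero_cols_eq_zero_iff:
  assumes A: "A \<in> carrier_mat m n"
  shows "A @\<^sub>c 0\<^sub>m m k = 0\<^sub>m m (n + k) \<longleftrightarrow> A = 0\<^sub>m m n"
proof
  assume eq: "A @\<^sub>c 0\<^sub>m m k = 0\<^sub>m m (n + k)"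
  have "A $$ (i, j) = 0" if "i < m" "j < n" for i j
    using index_append_cols[of i A j "0\<^sub>m m k"] A that by (simp add: eq)
  then show "A = 0\<^sub>m m n"
    using A by (intro eq_matI) auto
next
  assume "A = 0\<^sub>m m n"
  then show "A @\<^sub>c 0\<^sub>m m k = 0\<^sub>m m (n + k)"
    by (simp add: append_cols_def)
qed

theorem proposition3p10:
  fixes A :: "real mat" and m n p :: nat
  assumes "A \<in> carrier_mat m n" and "m \<le> n" and "p > n"
  shows "has_SIPP A \<longleftrightarrow> has_SIPP (A @\<^sub>c 0\<^sub>m m (p - n))"
proof -
  let ?B = "A @\<^sub>c 0\<^sub>m m (p - n)"
  have B: "?B \<in> carrier_mat m p"
    using append_cols_carrier[OF assms(1) zero_carrier_mat, of "p - n"] \<open>p > n\<close> by simp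
  \<comment> \<open>The size of X depends only on the number of rows, so both sides of the theorem
    quantify over the same symmetric matrices, and an equivalence for each single X is
    enough.\<close>
  have "(X * ?B) \<circ>\<^sub>H ?B = 0\<^sub>m m p \<longleftrightarrow> (X * A) \<circ>\<^sub>H A = 0\<^sub>m m n"
    if X: "X \<in> carrier_mat m m" for X
  proof -
    have XA: "X * A \<in> carrier_mat m n" "(X * A) \<circ>\<^sub>H A \<in> carrier_mat m n"
      using X assms(1) by (auto simp: hadamard_def)
    have "(X * ?B) \<circ>\<^sub>H ?B = ((X * A) \<circ>\<^sub>H A) @\<^sub>c (0\<^sub>m m (p - n) \<circ>\<^sub>H 0\<^sub>m m (p - n))"
      using X hadamard_append_cols[OF XA(1) zero_carrier_mat assms(1) zero_carrier_mat]
      by (simp add: mult_append_cols[OF X assms(1) zero_carrier_mat])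
    also have "0\<^sub>m m (p - n) \<circ>\<^sub>H 0\<^sub>m m (p - n) = (0\<^sub>m m (p - n) :: real mat)"
      by (intro eq_matI) (auto simp: hadamard_def)
    finally show ?thesis
      using append_zero_cols_eq_zero_iff[OF XA(2), of "p - n"] \<open>p > n\<close> by simp
  qed
  moreover have "vec_space.rank m ?B = vec_space.rank m A"
    by (rule rank_append_zero_cols[OF assms(1)])
  ultimately show ?thesis
    using assms B unfolding has_SIPP_def by auto
qed

end
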